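(* Let $g\geq 2$ be an integer, let $m\geq 1$ be an integer and let $\mathsf{C}_m$ be the cyclic group of order $m$. Then the number $N_g(\mathsf{C}_m)$ of admissible epimorphisms $\varphi\colon \mathsf{B}_2(\Sigma_g)\to \mathsf{C}_m$ is given by $$N_g(\mathsf{C}_m)=\begin{cases} 0 & \text{if } 2\nmid m,\\ 2^{2g}J_{2g}\left(\dfrac{m}{2}\right) & \text{if } 2\mid m.\end{cases}$$
   Context: Commutators are $[x,y]=xyx^{-1}y^{-1}$. Let $\Sigma_g$ be a compact Riemann surface of genus $g$. The full braid group on two strings $\mathsf{B}_2(\Sigma_g)\simeq\pi_1(\operatorname{Sym}^2\Sigma_g-\delta)$ (with $\delta$ the diagonal) is the group generated by $a_1,b_1,\dots,a_g,b_g,\sigma$ subject to the relations: $[a_i,\sigma^{-1}a_i\sigma^{-1}]=1$ and $[b_i,\sigma^{-1}b_i\sigma^{-1}]=1$ for $1\le i\le g$; $[a_i,\sigma^{-1}a_j\sigma]=[a_i,\sigma^{-1}b_j\sigma]=[b_i,\sigma^{-1}a_j\sigma]=[b_i,\sigma^{-1}b_j\sigma]=1$ for $j<i$; $[a_i,\sigma^{-1}b_i\sigma^{-1}]=\sigma^2$ for $1\le i\le g$; and $[a_1,b_1^{-1}]\cdots[a_g,b_g^{-1}]=\sigma^2$. For a finite group $G$, a group epimorphism $\varphi\colon\mathsf{B}_2(\Sigma_g)\to G$ is called admissible if $\varphi(\sigma)$ has order $n\ge 2$ (i.e. $\varphi(\sigma)\neq 1$). $N_g(G)$ denotes the total number of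 admissible epimorphisms $\mathsf{B}_2(\Sigma_g)\to G$. $J_k(m)$ is the Jordan totient: the number of ordered $k$-tuples of elements of $\mathsf{C}_m$ generating $\mathsf{C}_m$; equivalently $J_k(m)=m^k\prod_{p\mid m}(1-p^{-k})$, the product being over the distinct primes $p$ dividing $m$. *)

theory Defs
  imports "HOL-Algebra.Algebra"
begin

text \<open>
  A word over \<open>S\<close> is a list of letters; the letter \<open>(x, True)\<close> stands for the generator \<open>x\<close> and
  \<open>(x, False)\<close> for its inverse.
\<close>

type_synonym 'a word = "('a \<times> bool) list"

definition words :: "'a set \<Rightarrow> 'a word set" where
  "words S = lists (S \<times> UNIV)"

definition winv :: "'a word \<Rightarrow> 'a word" where
  "winv w = rev (map (\<lambda>(x, e). (x, \<not> e)) w)"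

definition wcomm :: "'a word \<Rightarrow> 'a word \<Rightarrow> 'a word" where
  "wcomm u v = u @ v @ winv u @ winv v"

text \<open>
  The group presented by generators \<open>S\<close> and relations \<open>u = v\<close>, for \<open>(u, v) \<in> R\<close>, is the quotient of
  the monoid of words by the smallest congruence that cancels adjacent inverse letters and
  contains \<open>R\<close>.
\<close>

inductive_set pres_rel :: "'a set \<Rightarrow> ('a word \<times> 'a word) set \<Rightarrow> ('a word \<times> 'a word) set"
  for S :: "'a set" and R :: "('a word \<times> 'a word) set"
  where
    refl: "w \<in> words S \<Longrightarrow> (w, w) \<in> pres_rel S R"
  | sym: "(u, v) \<in> pres_rel S R \<Longrightarrow> (v, u) \<in> pres_rel S R"
  | trans: "(u, v) \<in> pres_rel S R \<Longrightarrow> (v, w) \<in> pres_rel S R \<Longrightarrow> (u, w) \<in> pres_rel S R"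
  | append: "(u, u') \<in> pres_rel S R \<Longrightarrow> (v, v') \<in> pres_rel S R \<Longrightarrow> (u @ v, u' @ v') \<in> pres_rel S R"
  | cancel: "x \<in> S \<Longrightarrow> ([(x, e), (x, \<not> e)], []) \<in> pres_rel S R"
  | relation: "(u, v) \<in> R \<Longrightarrow> u \<in> words S \<Longrightarrow> v \<in> words S \<Longrightarrow> (u, v) \<in> pres_rel S R"

definition pres_class :: "'a set \<Rightarrow> ('a word \<times> 'a word) set \<Rightarrow> 'a word \<Rightarrow> 'a word set" where
  "pres_class S R w = pres_rel S R `` {w}"

definition presented_group :: "'a set \<Rightarrow> ('a word \<times> 'a word) set \<Rightarrow> 'a word set monoid" where
  "presented_group S R =
     \<lparr>carrier = words S // pres_rel S R,
      monoid.mult = (\<lambda>A B. \<Union>u\<in>A. \<Union>v\<in>B. pres_class S R (u @ v)),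
      one = pres_class S R []\<rparr>"

lemma words_Nil [simp]: "[] \<in> words S"
  and words_append [simp]: "u @ v \<in> words S \<longleftrightarrow> u \<in> words S \<and> v \<in> words S"
  by (auto simp: words_def)

lemma winv_in_words [simp]: "w \<in> words S \<Longrightarrow> winv w \<in> words S"
  unfolding words_def winv_def by (induction w) auto

lemma pres_rel_words: "(u, v) \<in> pres_rel S R \<Longrightarrow> u \<in> words S \<and> v \<in> words S"
  by (induction rule: pres_rel.induct) (simp_all add: words_def)

lemma equiv_pres_rel: "equiv (words S) (pres_rel S R)"
proof (rule equivI)
  show "pres_rel S R \<subseteq> words S \<times> words S"
    using pres_rel_words by fast
  show "refl_on (words S) (pres_rel S R)"
    by (rule refl_onI) (rule pres_rel.refl)
  show "Relation.sym (pres_rel S R)"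
    by (rule symI) (rule pres_rel.sym)
  show "Relation.trans (pres_rel S R)"
    by (rule transI) (rule pres_rel.trans)
qed

lemma pres_class_eq_iff:
  assumes "u \<in> words S" "v \<in> words S"
  shows "pres_class S R u = pres_class S R v \<longleftrightarrow> (u, v) \<in> pres_rel S R"
  unfolding pres_class_def by (rule eq_equiv_class_iff[OF equiv_pres_rel assms])

lemma carrier_presented_group: "carrier (presented_group S R) = pres_class S R ` words S"
  by (auto simp: presented_group_def quotient_def pres_class_def)

lemma one_presented_group: "\<one>\<^bsub>presented_group S R\<^esub> = pres_class S R []"
  by (simp add: presented_group_def)

lemma mult_presented_group:
  assumes "u \<in> words S" "v \<in> words S"
  shows "pres_class S R u \<otimes>\<^bsub>presented_group S R\<^esub> pres_class S R v = pres_class S R (u @ v)"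
proof -
  have "pres_class S R (a @ b) = pres_class S R (u @ v)"
    if "(u, a) \<in> pres_rel S R" "(v, b) \<in> pres_rel S R" for a b
  proof -
    have "(u @ v, a @ b) \<in> pres_rel S R"
      by (rule pres_rel.append[OF that])
    then show ?thesis
      unfolding pres_class_def by (rule equiv_class_eq[OF equiv_pres_rel, symmetric])
  qed
  then have "(\<Union>b\<in>pres_class S R v. pres_class S R (a @ b)) = pres_class S R (u @ v)"
    if "(u, a) \<in> pres_rel S R" for a
    using that pres_rel.refl[OF assms(2)] unfolding pres_class_def[of S R v]
    by (intro UN_constant_eq[of v]) simp_all
  then show ?thesis
    using pres_rel.refl[OF assms(1)] unfolding presented_group_def pres_class_def[of S R u]
    by (simp only: monoid.simps) (intro UN_constant_eq[of u], simp_all)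
qed

lemma winv_cancel: "w \<in> words S \<Longrightarrow> (winv w @ w, []) \<in> pres_rel S R"
proof (induction w)
  case Nil
  then show ?case by (simp add: winv_def pres_rel.refl)
next
  case (Cons l w)
  obtain x e where l: "l = (x, e)" by (cases l)
  have x: "x \<in> S" and w: "w \<in> words S" using Cons.prems by (auto simp: l words_def)
  have "([(x, \<not> e)] @ [(x, e)], []) \<in> pres_rel S R"
    using pres_rel.cancel[OF x, of "\<not> e"] by simp
  then have "(winv w @ ([(x, \<not> e)] @ [(x, e)]) @ w, winv w @ [] @ w) \<in> pres_rel S R"
    by (intro pres_rel.append) (simp_all add: pres_rel.refl w)
  then show ?case
    using pres_rel.trans[OF _ Cons.IH[OF w]] by (simp add: winv_def l)
qed

lemma group_presented_group: "group (presented_group S R)"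
proof (rule groupI)
  fix A assume "A \<in> carrier (presented_group S R)"
  then obtain w where w: "w \<in> words S" "A = pres_class S R w"
    by (auto simp: carrier_presented_group)
  then show "\<exists>B\<in>carrier (presented_group S R). B \<otimes>\<^bsub>presented_group S R\<^esub> A = \<one>\<^bsub>presented_group S R\<^esub>"
    by (intro bexI[of _ "pres_class S R (winv w)"])
      (auto simp: carrier_presented_group mult_presented_group one_presented_group
         pres_class_eq_iff winv_cancel)
qed (auto simp: carrier_presented_group mult_presented_group one_presented_group)

datatype braid_gen = GenA nat | GenB nat | GenSigma

definition braid_gens :: "nat \<Rightarrow> braid_gen set" where
  "braid_gens g = GenA ` {1..g} \<union> GenB ` {1..g} \<union> {GenSigma}"

definition wa :: "nat \<Rightarrow> braid_gen word" where "wa i = [(GenA i, True)]"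
definition wb :: "nat \<Rightarrow> braid_gen word" where "wb i = [(GenB i, True)]"
definition ws :: "braid_gen word" where "ws = [(GenSigma, True)]"

definition braid_rels :: "nat \<Rightarrow> (braid_gen word \<times> braid_gen word) set" where
  "braid_rels g =
     (\<Union>i\<in>{1..g}.
        {(wcomm (wa i) (winv ws @ wa i @ winv ws), []),
         (wcomm (wb i) (winv ws @ wb i @ winv ws), []),
         (wcomm (wa i) (winv ws @ wb i @ winv ws), ws @ ws)})
   \<union> (\<Union>i\<in>{1..g}. \<Union>j\<in>{1..<i}.
        {(wcomm (wa i) (winv ws @ wa j @ ws), []),
         (wcomm (wa i) (winv ws @ wb j @ ws), []),
         (wcomm (wb i) (winv ws @ wa j @ ws), []),
         (wcomm (wb i) (winv ws @ wb j @ ws), [])})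
   \<union> {(concat (map (\<lambda>i. wcomm (wa i) (winv (wb i))) [1..<Suc g]), ws @ ws)}"

definition surface_braid_group2 :: "nat \<Rightarrow> braid_gen word set monoid" where
  "surface_braid_group2 g = presented_group (braid_gens g) (braid_rels g)"

definition braid_sigma :: "nat \<Rightarrow> braid_gen word set" where
  "braid_sigma g = pres_class (braid_gens g) (braid_rels g) ws"

text \<open>
  HOL functions are total, so epimorphisms are taken to be extensional (constantly \<open>undefined\<close>
  off the carrier); otherwise one epimorphism would be counted infinitely often.
\<close>

definition admissible_epis :: "nat \<Rightarrow> ('b, 'c) monoid_scheme \<Rightarrow> (braid_gen word set \<Rightarrow> 'b) set" where
  "admissible_epis g G =
     {\<phi> \<in> epi (surface_braid_group2 g) G \<inter> extensional (carrier (surface_braid_group2 g)).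
        group.ord G (\<phi> (braid_sigma g)) \<ge> 2}"

definition num_admissible_epis :: "nat \<Rightarrow> ('b, 'c) monoid_scheme \<Rightarrow> nat" where
  "num_admissible_epis g G = card (admissible_epis g G)"

text \<open>Tuples are lists of length \<open>k\<close>; \<open>integer_mod_group m\<close> is cyclic of order \<open>m\<close> for \<open>m \<ge> 1\<close>.\<close>

definition jordan_totient :: "nat \<Rightarrow> nat \<Rightarrow> nat" where
  "jordan_totient k m =
     card {xs. length xs = k \<and> set xs \<subseteq> carrier (integer_mod_group m) \<and>
               generate (integer_mod_group m) (set xs) = carrier (integer_mod_group m)}"

end

theory Submission
  imports Defs
begin

text \<open>
  A homomorphism from a presented group to \<open>G\<close> is the same thing as an assignment of elements of
  \<open>G\<close> to the generators that satisfies the relations (\<open>hom_presented_group_bij\<close>), and it is onto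
  exactly when the assigned elements generate \<open>G\<close> (\<open>epi_presented_group_iff\<close>). If \<open>G\<close> is abelian,
  all commutators vanish, so the relations of the surface braid group leave the values of the
  \<open>2g\<close> generators \<open>a\<^sub>i, b\<^sub>i\<close> arbitrary and only demand \<open>s\<^sup>2 = 1\<close> for the value \<open>s\<close> of \<open>\<sigma>\<close>.
  Admissibility says \<open>s \<noteq> 1\<close>, so \<open>s\<close> is an involution.

  The group of integers modulo \<open>m\<close> has no involution for odd \<open>m\<close>, and exactly one, namely \<open>h\<close>,
  for \<open>m = 2h\<close>. It remains to count the \<open>2g\<close>-tuples that generate the integers modulo \<open>2h\<close>
  together with \<open>h\<close>. Since \<open>{0, h}\<close> is the kernel of reduction modulo \<open>h\<close>, these are the tuples
  whose reductions generate the integers modulo \<open>h\<close> (\<open>generate_kernel_Un_eq_carrier_iff\<close>). There are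
  \<open>J\<^sub>2\<^sub>g(h)\<close> generating tuples modulo \<open>h\<close>, and each one lifts in \<open>2\<^sup>2\<^sup>g\<close> ways, because every entry has
  two lifts (\<open>card_generating_with_involution\<close>).
\<close>

section \<open>Homomorphisms out of a presented group\<close>

definition word_value :: "('b, 'c) monoid_scheme \<Rightarrow> ('a \<Rightarrow> 'b) \<Rightarrow> 'a word \<Rightarrow> 'b" where
  "word_value G f w = foldr (\<lambda>(x, e) a. (if e then f x else inv\<^bsub>G\<^esub> f x) \<otimes>\<^bsub>G\<^esub> a) w \<one>\<^bsub>G\<^esub>"

text \<open>
  The guards match \<open>pres_rel\<close>, to which a pair of \<open>R\<close> contributes only if both sides are words
  over \<open>S\<close>.
\<close>

definition satisfies_rels ::
  "('b, 'c) monoid_scheme \<Rightarrow> 'a set \<Rightarrow> ('a word \<times> 'a word) set \<Rightarrow> ('a \<Rightarrow> 'b) \<Rightarrow> bool" where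
  "satisfies_rels G S R f \<longleftrightarrow>
     (\<forall>(u, v)\<in>R. u \<in> words S \<longrightarrow> v \<in> words S \<longrightarrow> word_value G f u = word_value G f v)"

definition pres_gen :: "'a set \<Rightarrow> ('a word \<times> 'a word) set \<Rightarrow> 'a \<Rightarrow> 'a word set" where
  "pres_gen S R x = pres_class S R [(x, True)]"

lemma words_Cons [simp]: "(x, e) # w \<in> words S \<longleftrightarrow> x \<in> S \<and> w \<in> words S"
  by (auto simp: words_def)

lemma word_value_Nil [simp]: "word_value G f [] = \<one>\<^bsub>G\<^esub>"
  and word_value_Cons: "word_value G f ((x, e) # w) =
    (if e then f x else inv\<^bsub>G\<^esub> f x) \<otimes>\<^bsub>G\<^esub> word_value G f w"
  by (simp_all add: word_value_def)

lemma winv_winv [simp]: "winv (winv w) = w"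
  by (simp add: winv_def rev_map comp_def case_prod_beta)

lemma winv_in_words_iff [simp]: "winv w \<in> words S \<longleftrightarrow> w \<in> words S"
  by (metis winv_in_words winv_winv)

lemma (in group) word_value_closed [simp]:
  "f \<in> S \<rightarrow> carrier G \<Longrightarrow> w \<in> words S \<Longrightarrow> word_value G f w \<in> carrier G"
proof (induction w)
  case (Cons l w)
  then show ?case by (cases l) (auto simp: word_value_Cons)
qed simp

lemma (in group) word_value_append:
  "f \<in> S \<rightarrow> carrier G \<Longrightarrow> u \<in> words S \<Longrightarrow> v \<in> words S \<Longrightarrow>
     word_value G f (u @ v) = word_value G f u \<otimes> word_value G f v"
proof (induction u)
  case (Cons l u)
  obtain x e where l: "l = (x, e)" by (cases l)
  have "f x \<in> carrier G" using Cons.prems by (auto simp: l)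
  moreover have "word_value G f u \<in> carrier G" "word_value G f v \<in> carrier G"
    using Cons.prems by (auto simp: l)
  ultimately show ?case using Cons by (simp add: l word_value_Cons m_assoc)
qed simp

lemma (in group) word_value_winv:
  "f \<in> S \<rightarrow> carrier G \<Longrightarrow> w \<in> words S \<Longrightarrow> word_value G f (winv w) = inv (word_value G f w)"
proof (induction w)
  case Nil
  then show ?case by (simp add: winv_def)
next
  case (Cons l w)
  obtain x e where l: "l = (x, e)" by (cases l)
  have x: "f x \<in> carrier G" "x \<in> S" "w \<in> words S" using Cons.prems by (auto simp: l)
  have w: "word_value G f w \<in> carrier G" using Cons.prems by (auto simp: l)
  have "winv (l # w) = winv w @ [(x, \<not> e)]" by (simp add: winv_def l)
  then have "word_value G f (winv (l # w)) = word_value G f (winv w) \<otimes> word_value G f [(x, \<not> e)]"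
    using Cons.prems x by (simp add: word_value_append)
  then show ?case
    using Cons x w by (auto simp: l word_value_Cons inv_mult_group)
qed

text \<open>
  The relation \<open>pres_rel S R\<close> is the least congruence that contains the cancellations and \<open>R\<close>, and
  words of equal value in \<open>G\<close> form another such congruence. This makes the value of a word a function
  of its class.
\<close>

lemma (in group) word_value_pres_rel:
  assumes f: "f \<in> S \<rightarrow> carrier G" and R: "satisfies_rels G S R f"
    and uv: "(u, v) \<in> pres_rel S R"
  shows "word_value G f u = word_value G f v"
  using uv
proof (induction rule: pres_rel.induct)
  case (append u u' v v')
  then show ?case using f pres_rel_words[of _ _ S R] by (metis word_value_append)
next
  case (cancel x e)
  have "f x \<in> carrier G" using f cancel by auto
  then show ?case by (simp add: word_value_Cons)
next
  case (relation u v)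
  then show ?case using R by (auto simp: satisfies_rels_def)
qed simp_all

lemma pres_gen_in_carrier: "x \<in> S \<Longrightarrow> pres_gen S R x \<in> carrier (presented_group S R)"
  by (simp add: pres_gen_def carrier_presented_group)

lemma pres_class_inverse_letter:
  assumes "x \<in> S"
  shows "pres_class S R [(x, False)] = inv\<^bsub>presented_group S R\<^esub> pres_gen S R x"
proof (rule group.inv_equality[OF group_presented_group, symmetric])
  have "([(x, False), (x, True)], []) \<in> pres_rel S R"
    using pres_rel.cancel[OF assms, of False R] by simp
  then show "pres_class S R [(x, False)] \<otimes>\<^bsub>presented_group S R\<^esub> pres_gen S R x =
      \<one>\<^bsub>presented_group S R\<^esub>"
    using assms by (simp add: pres_gen_def mult_presented_group one_presented_group pres_class_eq_iff)
  show "pres_class S R [(x, False)] \<in> carrier (presented_group S R)"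
    using assms by (simp add: carrier_presented_group)
qed (rule pres_gen_in_carrier[OF assms])

text \<open>
  A homomorphism is determined by its values on the generators, because each word is a product of
  generators and their inverses.
\<close>

lemma (in group) hom_presented_group_pres_class:
  assumes \<phi>: "\<phi> \<in> hom (presented_group S R) G" and w: "w \<in> words S"
  shows "\<phi> (pres_class S R w) = word_value G (\<lambda>x\<in>S. \<phi> (pres_gen S R x)) w"
  using w
proof (induction w)
  case Nil
  interpret P: group_hom "presented_group S R" G \<phi>
    using \<phi> by (simp add: group_hom_def group_hom_axioms_def group_presented_group)
  show ?case using P.hom_one by (simp add: one_presented_group)
next
  case (Cons l w)
  interpret P: group_hom "presented_group S R" G \<phi>
    using \<phi> by (simp add: group_hom_def group_hom_axioms_def group_presented_group)
  obtain x e where l: "l = (x, e)" by (cases l)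
  have x: "x \<in> S" "w \<in> words S" using Cons.prems by (auto simp: l)
  have letter: "\<phi> (pres_class S R [(x, e)]) =
      (if e then \<phi> (pres_gen S R x) else inv \<phi> (pres_gen S R x))"
    using x pres_class_inverse_letter[OF x(1), of R] pres_gen_in_carrier[OF x(1), of R]
    by (cases e) (simp_all flip: pres_gen_def)
  have "pres_class S R (l # w) =
      pres_class S R [(x, e)] \<otimes>\<^bsub>presented_group S R\<^esub> pres_class S R w"
    using x by (simp add: l mult_presented_group)
  then have "\<phi> (pres_class S R (l # w)) = \<phi> (pres_class S R [(x, e)]) \<otimes> \<phi> (pres_class S R w)"
    using x by (simp add: carrier_presented_group)
  then show ?case
    using Cons.IH x letter by (simp add: l word_value_Cons)
qed

lemma generate_presented_group:
  "generate (presented_group S R) (pres_gen S R ` S) = carrier (presented_group S R)"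
proof
  interpret P: group "presented_group S R" by (rule group_presented_group)
  have sub: "pres_gen S R ` S \<subseteq> carrier (presented_group S R)"
    by (auto simp: pres_gen_in_carrier)
  then show "generate (presented_group S R) (pres_gen S R ` S) \<subseteq> carrier (presented_group S R)"
    by (rule P.generate_incl)
  let ?H = "generate (presented_group S R) (pres_gen S R ` S)"
  have "pres_class S R w \<in> ?H" if "w \<in> words S" for w
    using that
  proof (induction w)
    case Nil
    then show ?case using generate.one[of "presented_group S R"] by (simp add: one_presented_group)
  next
    case (Cons l w)
    obtain x e where l: "l = (x, e)" by (cases l)
    have x: "x \<in> S" "w \<in> words S" using Cons.prems by (auto simp: l)
    have g: "pres_gen S R x \<in> ?H" using x by (auto intro: generate.incl)
    have "pres_class S R [(x, e)] \<in> ?H"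
      using g P.generate_m_inv_closed[OF sub g] pres_class_inverse_letter[OF x(1), of R]
      by (cases e) (simp_all flip: pres_gen_def)
    then have "pres_class S R [(x, e)] \<otimes>\<^bsub>presented_group S R\<^esub> pres_class S R w \<in> ?H"
      using Cons.IH x by (auto intro: generate.eng)
    then show ?case using x by (simp add: l mult_presented_group)
  qed
  then show "carrier (presented_group S R) \<subseteq> ?H"
    by (auto simp: carrier_presented_group)
qed

text \<open>
  The universal property of a presentation. It is stated for extensional functions on both sides,
  so that the correspondence is one-to-one and can be used for counting.
\<close>

lemma (in group) hom_presented_group_bij:
  "bij_betw (\<lambda>\<phi>. \<lambda>x\<in>S. \<phi> (pres_gen S R x))
     (hom (presented_group S R) G \<inter> extensional (carrier (presented_group S R)))
     {f \<in> S \<rightarrow>\<^sub>E carrier G. satisfies_rels G S R f}"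
proof (rule bij_betwI')
  fix \<phi> \<psi>
  assume "\<phi> \<in> hom (presented_group S R) G \<inter> extensional (carrier (presented_group S R))"
    and "\<psi> \<in> hom (presented_group S R) G \<inter> extensional (carrier (presented_group S R))"
  then have \<phi>: "\<phi> \<in> hom (presented_group S R) G" "\<phi> \<in> extensional (carrier (presented_group S R))"
    and \<psi>: "\<psi> \<in> hom (presented_group S R) G" "\<psi> \<in> extensional (carrier (presented_group S R))"
    by auto
  show "(\<lambda>x\<in>S. \<phi> (pres_gen S R x)) = (\<lambda>x\<in>S. \<psi> (pres_gen S R x)) \<longleftrightarrow> \<phi> = \<psi>"
  proof
    assume eq: "(\<lambda>x\<in>S. \<phi> (pres_gen S R x)) = (\<lambda>x\<in>S. \<psi> (pres_gen S R x))"
    show "\<phi> = \<psi>"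
    proof (rule extensionalityI[OF \<phi>(2) \<psi>(2)])
      fix A assume "A \<in> carrier (presented_group S R)"
      then obtain w where "w \<in> words S" "A = pres_class S R w"
        by (auto simp: carrier_presented_group)
      then show "\<phi> A = \<psi> A"
        using eq by (simp add: hom_presented_group_pres_class[OF \<phi>(1)]
            hom_presented_group_pres_class[OF \<psi>(1)])
    qed
  qed simp
next
  fix \<phi>
  assume "\<phi> \<in> hom (presented_group S R) G \<inter> extensional (carrier (presented_group S R))"
  then have \<phi>: "\<phi> \<in> hom (presented_group S R) G" by simp
  have "\<phi> (pres_class S R u) = \<phi> (pres_class S R v)"
    if "(u, v) \<in> R" "u \<in> words S" "v \<in> words S" for u v
    using that by (simp add: pres_class_eq_iff[THEN iffD2] pres_rel.relation)
  then have "satisfies_rels G S R (\<lambda>x\<in>S. \<phi> (pres_gen S R x))"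
    by (auto simp: satisfies_rels_def simp flip: hom_presented_group_pres_class[OF \<phi>])
  then show "(\<lambda>x\<in>S. \<phi> (pres_gen S R x)) \<in> {f \<in> S \<rightarrow>\<^sub>E carrier G. satisfies_rels G S R f}"
    using hom_in_carrier[OF \<phi>] by (auto simp: pres_gen_in_carrier)
next
  fix f assume "f \<in> {f \<in> S \<rightarrow>\<^sub>E carrier G. satisfies_rels G S R f}"
  then have fE: "f \<in> S \<rightarrow>\<^sub>E carrier G" and f: "f \<in> S \<rightarrow> carrier G" and R: "satisfies_rels G S R f"
    by auto
  \<comment> \<open>The choice of the representative is immaterial by \<open>word_value_pres_rel\<close>.\<close>
  define \<phi> where
    "\<phi> = (\<lambda>A\<in>carrier (presented_group S R). word_value G f (SOME w. w \<in> words S \<and> A = pres_class S R w))"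
  have \<phi>: "\<phi> (pres_class S R w) = word_value G f w" if w: "w \<in> words S" for w
  proof -
    let ?v = "SOME v. v \<in> words S \<and> pres_class S R w = pres_class S R v"
    have "?v \<in> words S \<and> pres_class S R w = pres_class S R ?v"
      by (rule someI[of _ w]) (simp add: w)
    then have "word_value G f w = word_value G f ?v"
      using w by (auto simp: pres_class_eq_iff intro: word_value_pres_rel[OF f R])
    then show ?thesis using w by (simp add: \<phi>_def carrier_presented_group)
  qed
  have "\<phi> \<in> hom (presented_group S R) G"
    by (rule homI)
      (auto simp: carrier_presented_group \<phi> mult_presented_group word_value_append[OF f]
        word_value_closed[OF f])
  moreover have "f = (\<lambda>x\<in>S. \<phi> (pres_gen S R x))"
  proof
    fix x
    have "\<phi> (pres_gen S R x) = f x" if "x \<in> S"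
    proof -
      have "f x \<in> carrier G" using f that by auto
      then show ?thesis using that by (simp add: pres_gen_def \<phi> word_value_Cons)
    qed
    then show "f x = (\<lambda>x\<in>S. \<phi> (pres_gen S R x)) x"
      using fE by (auto simp: PiE_def extensional_def)
  qed
  moreover have "\<phi> \<in> extensional (carrier (presented_group S R))"
    by (simp add: \<phi>_def)
  ultimately show "\<exists>\<phi>\<in>hom (presented_group S R) G \<inter> extensional (carrier (presented_group S R)).
      f = (\<lambda>x\<in>S. \<phi> (pres_gen S R x))"
    by blast
qed

lemma (in group) epi_presented_group_iff:
  assumes \<phi>: "\<phi> \<in> hom (presented_group S R) G"
  shows "\<phi> \<in> epi (presented_group S R) G \<longleftrightarrow>
    generate G ((\<lambda>x\<in>S. \<phi> (pres_gen S R x)) ` S) = carrier G"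
proof -
  interpret P: group_hom "presented_group S R" G \<phi>
    using \<phi> by (simp add: group_hom_def group_hom_axioms_def group_presented_group)
  have "generate G (\<phi> ` pres_gen S R ` S) = \<phi> ` carrier (presented_group S R)"
    by (subst P.generate_img) (auto simp: pres_gen_in_carrier generate_presented_group)
  moreover have "(\<lambda>x\<in>S. \<phi> (pres_gen S R x)) ` S = \<phi> ` pres_gen S R ` S"
    by auto
  ultimately show ?thesis using \<phi> by (simp add: epi_def)
qed

section \<open>The braid relations in an abelian group\<close>

lemma wcomm_in_words [simp]: "wcomm u v \<in> words S \<longleftrightarrow> u \<in> words S \<and> v \<in> words S"
  by (auto simp: wcomm_def)

lemma (in comm_group) word_value_wcomm:
  assumes f: "f \<in> S \<rightarrow> carrier G" and "wcomm u v \<in> words S"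
  shows "word_value G f (wcomm u v) = \<one>"
proof -
  have uv: "u \<in> words S" "v \<in> words S" using assms by auto
  then have c: "word_value G f u \<in> carrier G" "word_value G f v \<in> carrier G" using f by auto
  have "word_value G f (wcomm u v) =
      word_value G f u \<otimes> (word_value G f v \<otimes> (inv word_value G f u \<otimes> inv word_value G f v))"
    using uv by (simp add: wcomm_def word_value_append[OF f] word_value_winv[OF f])
  also have "\<dots> = (word_value G f u \<otimes> word_value G f v) \<otimes> inv (word_value G f u \<otimes> word_value G f v)"
    using c by (simp add: m_assoc inv_mult)
  finally show ?thesis using c by simp
qed

lemma (in comm_group) word_value_concat_wcomm:
  assumes f: "f \<in> S \<rightarrow> carrier G" and "concat (map (\<lambda>i. wcomm (u i) (v i)) is) \<in> words S"
  shows "word_value G f (concat (map (\<lambda>i. wcomm (u i) (v i)) is)) = \<one>"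
  using assms(2)
  by (induction "is") (simp_all add: word_value_append[OF f] word_value_wcomm[OF f])

lemma GenSigma_in_braid_gens [simp]: "GenSigma \<in> braid_gens g"
  by (simp add: braid_gens_def)

text \<open>
  Each relation equates a product of commutators, which vanishes in an abelian group, with the
  empty word or with \<open>\<sigma>\<^sup>2\<close>. A relation of the second kind exists for every genus \<open>g \<ge> 1\<close>.
\<close>

lemma (in comm_group) satisfies_braid_rels_iff:
  assumes g: "g \<ge> 1" and f: "f \<in> braid_gens g \<rightarrow> carrier G"
  shows "satisfies_rels G (braid_gens g) (braid_rels g) f \<longleftrightarrow> f GenSigma \<otimes> f GenSigma = \<one>"
proof -
  have "f GenSigma \<in> carrier G" using f by auto
  then have sq: "word_value G f (ws @ ws) = f GenSigma \<otimes> f GenSigma"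
    by (simp add: ws_def word_value_Cons)
  \<comment> \<open>one of the relations with right-hand side \<open>\<sigma>\<^sup>2\<close>\<close>
  let ?r = "wcomm (wa 1) (winv ws @ wb 1 @ winv ws)"
  show ?thesis
  proof
    have r: "(?r, ws @ ws) \<in> braid_rels g" using g by (auto simp: braid_rels_def)
    have w: "?r \<in> words (braid_gens g)" "ws @ ws \<in> words (braid_gens g)"
      using g by (auto simp: wa_def wb_def ws_def braid_gens_def)
    assume "satisfies_rels G (braid_gens g) (braid_rels g) f"
    then have "word_value G f ?r = word_value G f (ws @ ws)"
      using r w unfolding satisfies_rels_def by blast
    then show "f GenSigma \<otimes> f GenSigma = \<one>"
      by (simp only: sq word_value_wcomm[OF f w(1)])
  next
    assume s: "f GenSigma \<otimes> f GenSigma = \<one>"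
    show "satisfies_rels G (braid_gens g) (braid_rels g) f"
      unfolding satisfies_rels_def
    proof (clarify)
      fix u v assume uv: "(u, v) \<in> braid_rels g" "u \<in> words (braid_gens g)"
      have "word_value G f v = \<one>"
        using uv(1) s sq by (auto simp: braid_rels_def)
      moreover have "word_value G f u = \<one>"
        using uv unfolding braid_rels_def
        by (auto simp del: wcomm_in_words intro!: word_value_wcomm[OF f] word_value_concat_wcomm[OF f])
      ultimately show "word_value G f u = word_value G f v" by simp
    qed
  qed
qed

lemma (in comm_group) admissible_epis_bij:
  assumes g: "g \<ge> 1"
  shows "bij_betw (\<lambda>\<phi>. \<lambda>x\<in>braid_gens g. \<phi> (pres_gen (braid_gens g) (braid_rels g) x))
    (admissible_epis g G)
    {f \<in> braid_gens g \<rightarrow>\<^sub>E carrier G. f GenSigma \<otimes> f GenSigma = \<one> \<and> f GenSigma \<noteq> \<one> \<and>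
       generate G (f ` braid_gens g) = carrier G}"
proof -
  let ?S = "braid_gens g" and ?R = "braid_rels g"
  let ?P = "presented_group ?S ?R"
  let ?F = "\<lambda>\<phi>. \<lambda>x\<in>?S. \<phi> (pres_gen ?S ?R x)"
  have ord: "ord s \<ge> 2 \<longleftrightarrow> s \<noteq> \<one>" if s: "s \<in> carrier G" "s \<otimes> s = \<one>" for s
  proof -
    have "s [^] (2::nat) = \<one>" using s by (simp add: numeral_2_eq_2)
    \<comment> \<open>\<open>ord\<close> is \<open>0\<close> on elements of infinite order, so \<open>s \<noteq> \<one>\<close> alone would not give \<open>ord s \<ge> 2\<close>.\<close>
    then have "ord s dvd 2" using s pow_eq_id by blast
    then have "ord s \<noteq> 0" by (intro notI) simp
    then show ?thesis using ord_eq_1[OF s(1)] by linarith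
  qed
  let ?A = "hom ?P G \<inter> extensional (carrier ?P)"
  let ?B = "{f \<in> ?S \<rightarrow>\<^sub>E carrier G. satisfies_rels G ?S ?R f}"
  have b: "bij_betw ?F ?A ?B" by (rule hom_presented_group_bij)
  have "bij_betw ?F {\<phi> \<in> ?A. \<phi> \<in> epi ?P G \<and> ord (\<phi> (braid_sigma g)) \<ge> 2}
     {f \<in> ?B. generate G (f ` ?S) = carrier G \<and> f GenSigma \<noteq> \<one>}"
  proof (rule bij_betw_Collect[OF b])
    fix \<phi> assume \<phi>: "\<phi> \<in> ?A"
    define f where "f = ?F \<phi>"
    have "f \<in> ?B" unfolding f_def using \<phi> by (rule bij_betw_apply[OF b])
    then have f: "f \<in> ?S \<rightarrow> carrier G" and R: "satisfies_rels G ?S ?R f" by auto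
    have s: "f GenSigma = \<phi> (braid_sigma g)"
      by (simp add: f_def pres_gen_def braid_sigma_def ws_def)
    have "f GenSigma \<otimes> f GenSigma = \<one>"
      using satisfies_braid_rels_iff[OF g f] R by (rule iffD1)
    moreover have "f GenSigma \<in> carrier G" using f by (rule funcset_mem) simp
    ultimately have "ord (f GenSigma) \<ge> 2 \<longleftrightarrow> f GenSigma \<noteq> \<one>"
      by (intro ord)
    moreover have "\<phi> \<in> epi ?P G \<longleftrightarrow> generate G (f ` ?S) = carrier G"
      unfolding f_def using \<phi> by (intro epi_presented_group_iff) (rule IntD1)
    ultimately show "(generate G (?F \<phi> ` ?S) = carrier G \<and> ?F \<phi> GenSigma \<noteq> \<one>) \<longleftrightarrow>
        (\<phi> \<in> epi ?P G \<and> ord (\<phi> (braid_sigma g)) \<ge> 2)"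
      unfolding f_def[symmetric] s by simp
  qed
  moreover have "{\<phi> \<in> ?A. \<phi> \<in> epi ?P G \<and> ord (\<phi> (braid_sigma g)) \<ge> 2} = admissible_epis g G"
    unfolding admissible_epis_def surface_braid_group2_def epi_def by blast
  moreover have "{f \<in> ?B. generate G (f ` ?S) = carrier G \<and> f GenSigma \<noteq> \<one>} =
    {f \<in> ?S \<rightarrow>\<^sub>E carrier G. f GenSigma \<otimes> f GenSigma = \<one> \<and> f GenSigma \<noteq> \<one> \<and>
       generate G (f ` ?S) = carrier G}"
  proof (rule Collect_cong)
    fix f
    have "f \<in> ?S \<rightarrow>\<^sub>E carrier G \<Longrightarrow>
        satisfies_rels G ?S ?R f \<longleftrightarrow> f GenSigma \<otimes> f GenSigma = \<one>"
      by (rule satisfies_braid_rels_iff[OF g]) (simp add: PiE_def)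
    then show "(f \<in> ?B \<and> generate G (f ` ?S) = carrier G \<and> f GenSigma \<noteq> \<one>) \<longleftrightarrow>
        (f \<in> ?S \<rightarrow>\<^sub>E carrier G \<and> f GenSigma \<otimes> f GenSigma = \<one> \<and> f GenSigma \<noteq> \<one> \<and>
          generate G (f ` ?S) = carrier G)"
      unfolding mem_Collect_eq by blast
  qed
  ultimately show ?thesis by (simp only:)
qed

section \<open>Generating tuples modulo an involution\<close>

text \<open>
  Assignments to the generators are functions, whereas the Jordan totient counts lists. This lemma
  passes from one to the other once the value at one distinguished generator \<open>z\<close> is prescribed.
\<close>

lemma bij_betw_funcset_lists:
  assumes L: "distinct L" and z: "z \<notin> set L" and s: "s \<in> A"
  shows "bij_betw (\<lambda>f. map f L) {f \<in> insert z (set L) \<rightarrow>\<^sub>E A. f z = s}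
           {xs. length xs = length L \<and> set xs \<subseteq> A}"
proof (rule bij_betwI')
  fix f f' assume f: "f \<in> {f \<in> insert z (set L) \<rightarrow>\<^sub>E A. f z = s}"
    and f': "f' \<in> {f \<in> insert z (set L) \<rightarrow>\<^sub>E A. f z = s}"
  show "map f L = map f' L \<longleftrightarrow> f = f'"
  proof
    assume "map f L = map f' L"
    then have eq: "f x = f' x" if "x \<in> insert z (set L)" for x
      using f f' that by auto
    show "f = f'" by (rule PiE_ext[of f "insert z (set L)" "\<lambda>_. A"]) (use f f' eq in auto)
  qed simp
next
  fix f assume "f \<in> {f \<in> insert z (set L) \<rightarrow>\<^sub>E A. f z = s}"
  then show "map f L \<in> {xs. length xs = length L \<and> set xs \<subseteq> A}" by auto
next
  fix xs assume xs: "xs \<in> {xs. length xs = length L \<and> set xs \<subseteq> A}"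
  define f where "f = (\<lambda>x\<in>insert z (set L). if x = z then s else the (map_of (zip L xs) x))"
  have nth: "f (L ! i) = xs ! i" if "i < length L" for i
  proof -
    have "L ! i \<noteq> z" using z that by auto
    then show ?thesis
      using that xs L by (simp add: f_def map_of_zip_nth)
  qed
  then have eq: "map f L = xs" using xs by (auto intro: nth_equalityI)
  have "f \<in> insert z (set L) \<rightarrow>\<^sub>E A"
  proof (rule PiE_I)
    fix x assume "x \<in> insert z (set L)"
    moreover have "f ` set L \<subseteq> A" using eq xs by (metis (no_types, lifting) mem_Collect_eq set_map)
    ultimately show "f x \<in> A" using s by (auto simp: f_def)
  qed (simp add: f_def)
  then show "\<exists>f\<in>{f \<in> insert z (set L) \<rightarrow>\<^sub>E A. f z = s}. xs = map f L"
    using eq by (intro bexI[of _ f]) (auto simp: f_def)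
qed

text \<open>
  The lattice correspondence between subgroups of \<open>H\<close> and subgroups of \<open>G\<close> that contain the kernel,
  in the form needed here. For the direction from \<open>H\<close> to \<open>G\<close>, an element of \<open>G\<close> differs by an element
  of the kernel from some element of the subgroup generated by the kernel and \<open>B\<close>.
\<close>

lemma (in group_hom) generate_kernel_Un_eq_carrier_iff:
  assumes surj: "h ` carrier G = carrier H" and B: "B \<subseteq> carrier G"
  shows "generate G (kernel G H h \<union> B) = carrier G \<longleftrightarrow> generate H (h ` B) = carrier H"
proof -
  let ?K = "generate G (kernel G H h \<union> B)"
  have sub: "kernel G H h \<union> B \<subseteq> carrier G" using B by (auto simp: kernel_def)
  have subg: "subgroup ?K G" by (rule G.generate_is_subgroup[OF sub])
  have img: "h ` ?K = generate H (h ` B)"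
  proof
    have "subgroup (generate H (h ` B)) H"
      using B by (intro H.generate_is_subgroup) auto
    then have "\<one>\<^bsub>H\<^esub> \<in> generate H (h ` B)" by (rule subgroup.one_closed)
    then have "h ` (kernel G H h \<union> B) \<subseteq> generate H (h ` B)"
      by (auto simp: kernel_def intro: generate.incl)
    then have "generate H (h ` (kernel G H h \<union> B)) \<subseteq> generate H (h ` B)"
      using \<open>subgroup (generate H (h ` B)) H\<close> by (rule H.generate_subgroup_incl)
    then show "h ` ?K \<subseteq> generate H (h ` B)" by (simp add: generate_img[OF sub])
    have "generate H (h ` B) \<subseteq> generate H (h ` (kernel G H h \<union> B))"
      by (rule H.mono_generate) auto
    then show "generate H (h ` B) \<subseteq> h ` ?K" by (simp add: generate_img[OF sub])
  qed
  show ?thesis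
  proof
    assume "?K = carrier G"
    then show "generate H (h ` B) = carrier H" using img surj by simp
  next
    assume gen: "generate H (h ` B) = carrier H"
    have "y \<in> ?K" if y: "y \<in> carrier G" for y
    proof -
      have "h y \<in> h ` ?K" using img gen y by simp
      then obtain k where k: "k \<in> ?K" "h y = h k" by auto
      have kc: "k \<in> carrier G" using k(1) subgroup.subset[OF subg] by auto
      have "y \<otimes> inv k \<in> kernel G H h" using y kc k(2) by (simp add: kernel_def)
      then have "y \<otimes> inv k \<in> ?K" by (auto intro: generate.incl)
      then have "y \<otimes> inv k \<otimes> k \<in> ?K" using k(1) by (rule generate.eng)
      then show ?thesis using y kc by (simp add: G.m_assoc)
    qed
    then show "?K = carrier G" using subgroup.subset[OF subg] by auto
  qed
qed

lemma (in group) generate_insert_one: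
  assumes "B \<subseteq> carrier G"
  shows "generate G (insert \<one> B) = generate G B"
proof
  show "generate G (insert \<one> B) \<subseteq> generate G B"
    by (rule generate_subgroup_incl[OF _ generate_is_subgroup[OF assms]])
      (auto intro: generate.intros)
qed (rule mono_generate, auto)

lemma zero_or_eq_if_dvd_less_double:
  fixes n x :: int
  assumes "0 \<le> x" "x < 2 * n" "n dvd x"
  shows "x = 0 \<or> x = n"
proof -
  obtain k where k: "x = n * k" using assms(3) by (rule dvdE)
  have n: "0 < n" using assms by linarith
  have "n * 0 \<le> n * k" "n * k < n * 2" using assms(1,2) unfolding k by (simp_all only: mult_zero_right mult.commute)
  then have "0 \<le> k" "k < 2"
    unfolding mult_le_cancel_left_pos[OF n] mult_less_cancel_left_pos[OF n] .
  then have "k = 0 \<or> k = 1" by linarith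
  then show ?thesis using k by auto
qed

lemma generate_double_mod_group_iff:
  assumes h: "h \<ge> 1" and B: "B \<subseteq> carrier (integer_mod_group (2 * h))"
  shows "generate (integer_mod_group (2 * h)) (insert (int h) B) = carrier (integer_mod_group (2 * h))
    \<longleftrightarrow> generate (integer_mod_group h) ((\<lambda>x. x mod int h) ` B) = carrier (integer_mod_group h)"
proof -
  let ?G = "integer_mod_group (2 * h)" and ?H = "integer_mod_group h"
  let ?r = "\<lambda>x::int. x mod int h"
  interpret group_hom ?G ?H ?r
  proof -
    have "?r \<in> hom ?G ?H"
      using h by (auto simp: hom_def carrier_integer_mod_group mod_mod_cancel mod_add_eq)
    then show "group_hom ?G ?H ?r"
      by (simp add: group_hom_def group_hom_axioms_def)
  qed
  have "y \<in> ?r ` carrier ?G" if "y \<in> carrier ?H" for y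
    using that h by (intro image_eqI[of _ _ y]) (auto simp: carrier_integer_mod_group)
  then have surj: "?r ` carrier ?G = carrier ?H" using hom_closed by blast
  have "x = 0 \<or> x = int h" if "0 \<le> x" "x < 2 * int h" "x mod int h = 0" for x
    using that by (intro zero_or_eq_if_dvd_less_double) auto
  then have ker: "kernel ?G ?H ?r = {0, int h}"
    using h by (fastforce simp: kernel_def carrier_integer_mod_group)
  have "generate ?G (kernel ?G ?H ?r \<union> B) = generate ?G (insert \<one>\<^bsub>?G\<^esub> (insert (int h) B))"
    by (simp add: ker)
  also have "\<dots> = generate ?G (insert (int h) B)"
    using B h by (intro G.generate_insert_one) (auto simp: carrier_integer_mod_group)
  finally show ?thesis using generate_kernel_Un_eq_carrier_iff[OF surj B] by simp
qed

text \<open>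
  Division with remainder: an integer in \<open>{0..<2h}\<close> is \<open>y + h e\<close> for a unique \<open>y\<close> in \<open>{0..<h}\<close>, its
  reduction modulo \<open>h\<close>, and a unique \<open>e\<close> in \<open>{0, 1}\<close>, which selects one of the two lifts of \<open>y\<close>.
\<close>

lemma bij_betw_double_mod_group:
  assumes h: "h \<ge> 1"
  shows "bij_betw (\<lambda>xs. (map (\<lambda>x. x mod int h) xs, map (\<lambda>x. x div int h) xs))
    {xs. length xs = k \<and> set xs \<subseteq> {0..<int (2 * h)}}
    ({ys. length ys = k \<and> set ys \<subseteq> {0..<int h}} \<times> {es. set es \<subseteq> {0, 1::int} \<and> length es = k})"
proof (rule bij_betwI[where g = "\<lambda>(ys, es). map2 (\<lambda>y e. y + int h * e) ys es"])
  have "x div int h = 0 \<or> x div int h = 1" if "0 \<le> x" "x < 2 * int h" for x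
  proof -
    have "0 \<le> x div int h" using that h by (simp add: pos_imp_zdiv_nonneg_iff)
    moreover have "int h * (x div int h) < int h * 2"
      using that h mult_div_mod_eq[of "int h" x] pos_mod_sign[of "int h" x] by linarith
    then have "x div int h < 2" by (rule mult_less_cancel_left_pos[THEN iffD1, rotated]) (use h in simp)
    ultimately show ?thesis by linarith
  qed
  then have quot: "x div int h \<in> {0, 1}" if "x \<in> {0..<int (2 * h)}" for x
    using that by simp
  have rem: "x mod int h \<in> {0..<int h}" for x
    using h by simp
  show "(\<lambda>xs. (map (\<lambda>x. x mod int h) xs, map (\<lambda>x. x div int h) xs)) \<in>
      {xs. length xs = k \<and> set xs \<subseteq> {0..<int (2 * h)}} \<rightarrow>
      {ys. length ys = k \<and> set ys \<subseteq> {0..<int h}} \<times> {es. set es \<subseteq> {0, 1} \<and> length es = k}"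
    using quot rem
    by (intro funcsetI) (simp add: subset_iff del: insert_iff atLeastLessThan_iff, blast)
next
  show "(\<lambda>(ys, es). map2 (\<lambda>y e. y + int h * e) ys es) \<in>
      {ys. length ys = k \<and> set ys \<subseteq> {0..<int h}} \<times> {es. set es \<subseteq> {0, 1} \<and> length es = k} \<rightarrow>
      {xs. length xs = k \<and> set xs \<subseteq> {0..<int (2 * h)}}"
  proof (rule funcsetI, clarify)
    fix ys es :: "int list"
    assume ys: "set ys \<subseteq> {0..<int h}" and es: "set es \<subseteq> {0, 1}" and "k = length ys"
      and len: "length es = length ys"
    have "y + int h * e \<in> {0..<int (2 * h)}" if "(y, e) \<in> set (zip ys es)" for y e
    proof -
      have "y \<in> {0..<int h}" using that ys by (meson set_zip_leftD subsetD)
      moreover have "e = 0 \<or> e = 1" using that es by (meson insertE set_zip_rightD singletonD subsetD)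
      ultimately show ?thesis by auto
    qed
    then show "length (map2 (\<lambda>y e. y + int h * e) ys es) = length ys \<and>
        set (map2 (\<lambda>y e. y + int h * e) ys es) \<subseteq> {0..<int (2 * h)}"
      using len by (auto simp del: atLeastLessThan_iff)
  qed
next
  fix xs :: "int list"
  show "(\<lambda>(ys, es). map2 (\<lambda>y e. y + int h * e) ys es)
      (map (\<lambda>x. x mod int h) xs, map (\<lambda>x. x div int h) xs) = xs"
    by (auto intro: nth_equalityI)
next
  fix p :: "int list \<times> int list"
  assume p: "p \<in> {ys. length ys = k \<and> set ys \<subseteq> {0..<int h}} \<times> {es. set es \<subseteq> {0, 1} \<and> length es = k}"
  obtain ys es where ye: "p = (ys, es)" by (cases p)
  have len: "length ys = k" "length es = k" and ys: "set ys \<subseteq> {0..<int h}"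
    using p by (simp_all add: ye)
  have quot_rem: "ys ! i mod int h = ys ! i"
    "(ys ! i + int h * es ! i) div int h = es ! i" if "i < k" for i
  proof -
    have "ys ! i \<in> {0..<int h}" using ys len that nth_mem[of i ys] by blast
    then show "ys ! i mod int h = ys ! i"
      "(ys ! i + int h * es ! i) div int h = es ! i"
      using h by (simp, subst div_mult_self2) simp_all
  qed
  show "(\<lambda>xs. (map (\<lambda>x. x mod int h) xs, map (\<lambda>x. x div int h) xs))
      ((\<lambda>(ys, es). map2 (\<lambda>y e. y + int h * e) ys es) p) = p"
    unfolding ye prod.case by (intro prod_eqI nth_equalityI) (simp_all add: len quot_rem)
qed

text \<open>
  Whether a tuple generates together with \<open>h\<close> depends only on its reduction modulo \<open>h\<close>, so the \<open>k\<close>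
  quotients are free, which gives the factor \<open>2 ^ k\<close>.
\<close>

lemma card_generating_with_involution:
  assumes h: "h \<ge> 1"
  shows "card {xs. length xs = k \<and> set xs \<subseteq> carrier (integer_mod_group (2 * h)) \<and>
      generate (integer_mod_group (2 * h)) (insert (int h) (set xs)) = carrier (integer_mod_group (2 * h))}
    = 2 ^ k * jordan_totient k h"
proof -
  let ?G = "integer_mod_group (2 * h)" and ?H = "integer_mod_group h"
  let ?T = "\<lambda>xs. (map (\<lambda>x. x mod int h) xs, map (\<lambda>x. x div int h) xs)"
  let ?A = "{xs. length xs = k \<and> set xs \<subseteq> {0..<int (2 * h)}}"
  let ?Y = "{ys. length ys = k \<and> set ys \<subseteq> {0..<int h}}"
  let ?E = "{es. set es \<subseteq> {0, 1::int} \<and> length es = k}"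
  have G: "carrier ?G = {0..<int (2 * h)}" and H: "carrier ?H = {0..<int h}"
    using h by (auto simp: carrier_integer_mod_group)
  have "bij_betw ?T {xs \<in> ?A. generate ?G (insert (int h) (set xs)) = carrier ?G}
    {p \<in> ?Y \<times> ?E. generate ?H (set (fst p)) = carrier ?H}"
    by (rule bij_betw_Collect[OF bij_betw_double_mod_group[OF h]])
      (use generate_double_mod_group_iff[OF h] G in simp)
  then have "card {xs \<in> ?A. generate ?G (insert (int h) (set xs)) = carrier ?G} =
      card {p \<in> ?Y \<times> ?E. generate ?H (set (fst p)) = carrier ?H}"
    by (rule bij_betw_same_card)
  also have "{p \<in> ?Y \<times> ?E. generate ?H (set (fst p)) = carrier ?H} =
      {ys \<in> ?Y. generate ?H (set ys) = carrier ?H} \<times> ?E"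
    by auto
  also have "card \<dots> = jordan_totient k h * 2 ^ k"
    by (simp add: card_cartesian_product card_lists_length_eq jordan_totient_def H conj_assoc numeral_2_eq_2)
  finally show ?thesis unfolding G by (simp add: mult.commute[of "jordan_totient k h"])
qed

lemma mod_group_involution_iff:
  assumes m: "m \<ge> 1" and s: "s \<in> carrier (integer_mod_group m)"
  shows "s \<otimes>\<^bsub>integer_mod_group m\<^esub> s = \<one>\<^bsub>integer_mod_group m\<^esub> \<and> s \<noteq> \<one>\<^bsub>integer_mod_group m\<^esub> \<longleftrightarrow>
    int m = 2 * s"
proof -
  have s: "0 \<le> s" "s < int m" using s m by (auto simp: carrier_integer_mod_group)
  have "(s + s) mod int m = 0 \<longleftrightarrow> s = 0 \<or> int m = 2 * s"
  proof
    assume "(s + s) mod int m = 0"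
    then have "2 * s = 0 \<or> 2 * s = int m"
      using s by (intro zero_or_eq_if_dvd_less_double) auto
    then show "s = 0 \<or> int m = 2 * s" by auto
  qed auto
  then show ?thesis using m by auto
qed

section \<open>Counting admissible epimorphisms onto a cyclic group\<close>

definition surface_gens :: "nat \<Rightarrow> braid_gen list" where
  "surface_gens g = map GenA [1..<Suc g] @ map GenB [1..<Suc g]"

lemma length_surface_gens: "length (surface_gens g) = 2 * g"
  by (simp add: surface_gens_def)

lemma distinct_surface_gens: "distinct (surface_gens g)"
  by (auto simp: surface_gens_def distinct_map inj_on_def)

lemma GenSigma_notin_surface_gens: "GenSigma \<notin> set (surface_gens g)"
  by (auto simp: surface_gens_def)

lemma braid_gens_eq: "braid_gens g = insert GenSigma (set (surface_gens g))"
  by (auto simp: braid_gens_def surface_gens_def)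

theorem theoremA:
  fixes g m :: nat
  assumes "g \<ge> 2" and "m \<ge> 1"
  shows "num_admissible_epis g (integer_mod_group m) =
           (if \<not> 2 dvd m then 0 else 2 ^ (2 * g) * jordan_totient (2 * g) (m div 2))"
proof -
  let ?G = "integer_mod_group m" and ?S = "braid_gens g" and ?L = "surface_gens g"
  let ?gen = "\<lambda>f. generate ?G (f ` ?S) = carrier ?G"
  interpret comm_group ?G by simp
  have "bij_betw (\<lambda>\<phi>. \<lambda>x\<in>?S. \<phi> (pres_gen ?S (braid_rels g) x)) (admissible_epis g ?G)
    {f \<in> ?S \<rightarrow>\<^sub>E carrier ?G. f GenSigma \<otimes>\<^bsub>?G\<^esub> f GenSigma = \<one>\<^bsub>?G\<^esub> \<and> f GenSigma \<noteq> \<one>\<^bsub>?G\<^esub> \<and> ?gen f}"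
    by (rule admissible_epis_bij) (use assms in simp)
  also have "{f \<in> ?S \<rightarrow>\<^sub>E carrier ?G. f GenSigma \<otimes>\<^bsub>?G\<^esub> f GenSigma = \<one>\<^bsub>?G\<^esub> \<and> f GenSigma \<noteq> \<one>\<^bsub>?G\<^esub> \<and> ?gen f}
      = {f \<in> ?S \<rightarrow>\<^sub>E carrier ?G. int m = 2 * f GenSigma \<and> ?gen f}"
  proof (rule Collect_cong)
    fix f
    have "f GenSigma \<otimes>\<^bsub>?G\<^esub> f GenSigma = \<one>\<^bsub>?G\<^esub> \<and> f GenSigma \<noteq> \<one>\<^bsub>?G\<^esub> \<longleftrightarrow> int m = 2 * f GenSigma"
      if "f \<in> ?S \<rightarrow>\<^sub>E carrier ?G"
      using PiE_mem[OF that GenSigma_in_braid_gens] by (rule mod_group_involution_iff[OF assms(2)])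
    then show "(f \<in> ?S \<rightarrow>\<^sub>E carrier ?G \<and> f GenSigma \<otimes>\<^bsub>?G\<^esub> f GenSigma = \<one>\<^bsub>?G\<^esub> \<and>
        f GenSigma \<noteq> \<one>\<^bsub>?G\<^esub> \<and> ?gen f) \<longleftrightarrow>
      (f \<in> ?S \<rightarrow>\<^sub>E carrier ?G \<and> int m = 2 * f GenSigma \<and> ?gen f)"
      by blast
  qed
  finally have count: "num_admissible_epis g ?G =
      card {f \<in> ?S \<rightarrow>\<^sub>E carrier ?G. int m = 2 * f GenSigma \<and> ?gen f}"
    unfolding num_admissible_epis_def by (rule bij_betw_same_card)
  show ?thesis
  proof (cases "2 dvd m")
    case False
    then have "int m \<noteq> 2 * s" for s by presburger
    then have "{f \<in> ?S \<rightarrow>\<^sub>E carrier ?G. int m = 2 * f GenSigma \<and> ?gen f} = {}" by blast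
    then have "num_admissible_epis g ?G = 0" by (simp only: count card.empty)
    then show ?thesis using False by simp
  next
    case True
    then obtain h where h: "m = 2 * h" by auto
    have h1: "h \<ge> 1" using assms(2) h by simp
    have "int h \<in> carrier ?G" using h h1 by (simp add: carrier_integer_mod_group)
    then have "bij_betw (\<lambda>f. map f ?L) {f \<in> insert GenSigma (set ?L) \<rightarrow>\<^sub>E carrier ?G. f GenSigma = int h}
           {xs. length xs = length ?L \<and> set xs \<subseteq> carrier ?G}"
      by (rule bij_betw_funcset_lists[OF distinct_surface_gens GenSigma_notin_surface_gens])
    then have "bij_betw (\<lambda>f. map f ?L)
      {f \<in> {f \<in> insert GenSigma (set ?L) \<rightarrow>\<^sub>E carrier ?G. f GenSigma = int h}. ?gen f}
      {xs \<in> {xs. length xs = length ?L \<and> set xs \<subseteq> carrier ?G}.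
         generate ?G (insert (int h) (set xs)) = carrier ?G}"
      by (rule bij_betw_Collect) (auto simp: braid_gens_eq)
    then have "card {f \<in> {f \<in> insert GenSigma (set ?L) \<rightarrow>\<^sub>E carrier ?G. f GenSigma = int h}. ?gen f} =
      card {xs \<in> {xs. length xs = length ?L \<and> set xs \<subseteq> carrier ?G}.
         generate ?G (insert (int h) (set xs)) = carrier ?G}"
      by (rule bij_betw_same_card)
    also have "{f \<in> {f \<in> insert GenSigma (set ?L) \<rightarrow>\<^sub>E carrier ?G. f GenSigma = int h}. ?gen f} =
        {f \<in> ?S \<rightarrow>\<^sub>E carrier ?G. int m = 2 * f GenSigma \<and> ?gen f}"
      by (auto simp: h braid_gens_eq)
    also have "card {xs \<in> {xs. length xs = length ?L \<and> set xs \<subseteq> carrier ?G}.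
         generate ?G (insert (int h) (set xs)) = carrier ?G} = 2 ^ (2 * g) * jordan_totient (2 * g) h"
      using card_generating_with_involution[OF h1, of "2 * g"]
      by (simp add: h length_surface_gens conj_assoc)
    finally show ?thesis using True count by (simp add: h)
  qed
qed

end
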